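(* There is no transcendental entire function $f:\mathbb{C}\to\mathbb{C}$ with infinitely many zeros satisfying $$f'(z)^2+f''(z)^2=f(z)^2 .$$
   Context: Entire means holomorphic on all of $\mathbb{C}$; transcendental means not a polynomial. *)

theory Defs
  imports "HOL-Complex_Analysis.Complex_Analysis" "HOL-Computational_Algebra.Polynomial"
begin

definition transcendental_entire :: "(complex \<Rightarrow> complex) \<Rightarrow> bool" where
  "transcendental_entire f \<longleftrightarrow> f holomorphic_on UNIV \<and> (\<nexists>p :: complex poly. f = poly p)"

end

theory Submission
  imports Defs "HOL-Computational_Algebra.Fundamental_Theorem_Algebra"
begin

text \<open>
  It is shown that an entire solution \<open>f\<close> of \<open>f'\<^sup>2 + f''\<^sup>2 = f\<^sup>2\<close> having even a single zero vanishes
  identically. Dividing by \<open>f\<^sup>2\<close>, the pair \<open>(f'/f, f''/f)\<close> is a meromorphic curve on the conic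
  \<open>u\<^sup>2 + v\<^sup>2 = 1\<close>; projecting this conic from its point \<open>(-1, 0)\<close> gives the rational parameter
  \<open>S = v / (1 + u) = f'' / (f + f')\<close>. Differentiating the equation gives \<open>f'' (f' + f''') = f f'\<close>.
  At a zero of \<open>f''\<close> this yields \<open>f f' = 0\<close> along with \<open>f\<^sup>2 = f'\<^sup>2\<close>, so \<open>f\<close> and \<open>f'\<close> vanish there
  as well, and then \<open>f\<close> vanishes identically (\<open>entire_solution_common_zero\<close>). A zero of \<open>f + f'\<close>
  is a zero of \<open>f''\<close>. Hence, unless \<open>f = 0\<close>, \<open>f + f'\<close> and \<open>f''\<close> are zero-free, so \<open>S\<close> is entire and
  omits \<open>0\<close>. Moreover \<open>S\<close> satisfies the autonomous equation
  \<open>4 S S' = S\<^sup>4 - 2 S\<^sup>3 - 2 S\<^sup>2 - 2 S + 1\<close>.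

  Let \<open>c\<close> be a root of the polynomial on the right; it is nonzero. By uniqueness of solutions
  (\<open>entire_linear_ode_zero\<close>), \<open>S\<close> either omits \<open>c\<close> as well or is equal to \<open>c\<close> throughout, and little
  Picard makes \<open>S\<close> constant in the former case (\<open>zero_free_autonomous_constant\<close>). Constancy of \<open>S\<close>
  says that \<open>f f'' = f'\<^sup>2\<close>, so at a zero of \<open>f\<close> also \<open>f'\<close> and \<open>f''\<close> vanish, which brings back
  the excluded case.
\<close>

lemma entire_linear_ode_zero:
  fixes Y A :: "complex \<Rightarrow> complex"
  assumes A: "A holomorphic_on UNIV"
    and Y: "\<And>z. (Y has_field_derivative A z * Y z) (at z)"
    and a: "Y a = 0"
  shows "Y z = 0"
proof -
  obtain B where B: "\<And>z. (B has_field_derivative A z) (at z)"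
    using holomorphic_convex_primitive'[OF convex_UNIV open_UNIV A] by auto
  have "((\<lambda>z. Y z * exp (- B z)) has_field_derivative 0) (at z within UNIV)" for z
    by (rule derivative_eq_intros Y B refl)+ simp
  then have "Y z * exp (- B z) = Y a * exp (- B a)"
    using has_field_derivative_zero_constant[of UNIV "\<lambda>z. Y z * exp (- B z)"] by fastforce
  then show ?thesis using a by simp
qed

lemma zero_free_autonomous_constant:
  fixes S :: "complex \<Rightarrow> complex" and p :: "complex poly"
  assumes S: "\<And>z. (S has_field_derivative poly p (S z) / S z) (at z)"
    and nz: "\<And>z. S z \<noteq> 0"
    and p0: "poly p 0 \<noteq> 0" and deg: "degree p > 0"
  obtains c where "S = (\<lambda>_. c)"
proof -
  have holS: "S holomorphic_on UNIV"
    using S by (auto simp: holomorphic_on_def field_differentiable_def)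
  obtain c where c: "poly p c = 0"
    using Fundamental_Theorem_Algebra.fundamental_theorem_of_algebra[of p] deg
    by (auto simp: constant_degree)
  then obtain q where q: "p = [:- c, 1:] * q"
    by (auto simp: poly_eq_0_iff_dvd elim: dvdE)
  have "c \<noteq> 0" using c p0 by auto
  show ?thesis
  proof (cases "\<exists>a. S a = c")
    case True
    then obtain a where a: "S a = c" by blast
    have hol: "(\<lambda>z. poly q (S z) / S z) holomorphic_on UNIV"
      using nz by (intro holomorphic_intros holS) auto
    have "((\<lambda>z. S z - c) has_field_derivative poly q (S z) / S z * (S z - c)) (at z)" for z
      by (rule derivative_eq_intros S refl)+ (simp add: q field_simps nz)
    from entire_linear_ode_zero[OF hol this, of a] have "S z - c = 0" for z
      using a by simp
    then show ?thesis using that[of c] by auto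
  next
    case False
    then have "range S \<inter> {0, c} = {}" using nz by auto
    then show ?thesis using little_Picard[OF holS] \<open>c \<noteq> 0\<close> that by metis
  qed
qed

text \<open>
  The equation cannot be solved smoothly for \<open>f''\<close> at the common zero, so standard uniqueness
  for initial values does not apply. However, it bounds \<open>f''\<close> by \<open>f\<close> and \<open>f'\<close>: if \<open>f''\<close> has maximum modulus \<open>M\<close> on the
  closed disc of radius \<open>1/2\<close> about the common zero, then \<open>f'\<close> and \<open>f\<close> are at most \<open>M/2\<close> and
  \<open>M/4\<close> there, whence \<open>M\<^sup>2 \<le> (1/4 + 1/16) M\<^sup>2\<close> and \<open>M = 0\<close>.
\<close>
lemma entire_solution_common_zero:
  fixes f f1 f2 :: "complex \<Rightarrow> complex"
  assumes f: "\<And>z. (f has_field_derivative f1 z) (at z)"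
    and f1: "\<And>z. (f1 has_field_derivative f2 z) (at z)"
    and f2: "continuous_on UNIV f2"
    and eq: "\<And>z. (f1 z)\<^sup>2 + (f2 z)\<^sup>2 = (f z)\<^sup>2"
    and a: "f a = 0" "f1 a = 0"
  shows "f z = 0"
proof -
  let ?D = "cball a (1/2)"
  obtain b where b: "b \<in> ?D" and M: "\<And>z. z \<in> ?D \<Longrightarrow> norm (f2 z) \<le> norm (f2 b)"
  proof -
    have "continuous_on ?D (\<lambda>z. norm (f2 z))"
      using continuous_on_subset[OF f2] by (auto intro!: continuous_on_norm)
    then show ?thesis
      using continuous_attains_sup[of ?D "\<lambda>z. norm (f2 z)"] that by fastforce
  qed
  define M where "M = norm (f2 b)"
  have growth: "norm (g z) \<le> B / 2"
    if g: "\<And>z. (g has_field_derivative g' z) (at z)" "g a = 0"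
      and B: "\<And>z. z \<in> ?D \<Longrightarrow> norm (g' z) \<le> B" and z: "z \<in> ?D" for g g' B z
  proof -
    have "norm (g z - g a) \<le> B * norm (z - a)"
      by (rule field_differentiable_bound[where S = ?D and f' = g'])
        (use g B z in \<open>auto intro: has_field_derivative_at_within\<close>)
    moreover have "B \<ge> 0" using B[OF z] norm_ge_zero order_trans by blast
    then have "B * norm (z - a) \<le> B * (1/2)"
      using z by (intro mult_left_mono) (auto simp: dist_norm norm_minus_commute)
    ultimately show ?thesis using g(2) by simp
  qed
  have f1b: "norm (f1 z) \<le> M / 2" if "z \<in> ?D" for z
    using growth[OF f1 a(2) M that] by (simp add: M_def)
  have fb: "norm (f z) \<le> M / 4" if "z \<in> ?D" for z
    using growth[OF f a(1) f1b that] by simp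
  have "M\<^sup>2 = norm ((f b)\<^sup>2 - (f1 b)\<^sup>2)"
    using eq[of b] by (simp add: M_def flip: norm_power) (metis add_diff_cancel_left')
  also have "\<dots> \<le> (norm (f b))\<^sup>2 + (norm (f1 b))\<^sup>2"
    using norm_triangle_ineq4[of "(f b)\<^sup>2" "(f1 b)\<^sup>2"] by (simp add: norm_power)
  also have "\<dots> \<le> (M / 4)\<^sup>2 + (M / 2)\<^sup>2"
    using fb[OF b] f1b[OF b] by (intro add_mono power_mono) auto
  finally have "M\<^sup>2 \<le> 0" by (simp add: power2_eq_square)
  then have "M = 0" by simp
  have holf: "f holomorphic_on UNIV"
    using f by (auto simp: holomorphic_on_def field_differentiable_def)
  have "f w = 0" if "w \<in> ball a (1/2)" for w
    using fb[of w] that \<open>M = 0\<close> by auto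
  then show "f z = 0"
    using analytic_continuation_open[of "ball a (1/2)" UNIV f "\<lambda>_. 0" z] holf by auto
qed

lemma entire_solution_with_zero:
  fixes f :: "complex \<Rightarrow> complex"
  assumes hol: "f holomorphic_on UNIV"
    and eq: "\<And>z. (deriv f z)\<^sup>2 + (deriv (deriv f) z)\<^sup>2 = (f z)\<^sup>2"
    and b: "f b = 0"
  shows "f z = 0"
proof (rule ccontr)
  assume nonzero: "f z \<noteq> 0"
  define f1 f2 f3 where "f1 = deriv f" and "f2 = deriv f1" and "f3 = deriv f2"
  have hol1: "f1 holomorphic_on UNIV" and hol2: "f2 holomorphic_on UNIV"
    unfolding f2_def f1_def using hol by (auto intro!: holomorphic_deriv)
  have f: "(f has_field_derivative f1 z) (at z)"
    and f1: "(f1 has_field_derivative f2 z) (at z)"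
    and f2: "(f2 has_field_derivative f3 z) (at z)" for z
    using holomorphic_derivI[OF hol open_UNIV] holomorphic_derivI[OF hol1 open_UNIV]
      holomorphic_derivI[OF hol2 open_UNIV] by (auto simp: f1_def f2_def f3_def)
  have eq0: "(f1 z)\<^sup>2 + (f2 z)\<^sup>2 = (f z)\<^sup>2" for z
    using eq by (simp add: f1_def f2_def)
  have no_common_zero: "\<not> (f z = 0 \<and> f1 z = 0)" for z
    using entire_solution_common_zero[OF f f1 holomorphic_on_imp_continuous_on[OF hol2] eq0]
      nonzero by blast
  have eq1: "f2 z * (f1 z + f3 z) = f z * f1 z" for z
  proof -
    have "((\<lambda>z. (f1 z)\<^sup>2 + (f2 z)\<^sup>2) has_field_derivative 2 * f1 z * f2 z + 2 * f2 z * f3 z) (at z)"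
      by (auto intro!: derivative_eq_intros f1 f2)
    moreover have "((\<lambda>z. (f1 z)\<^sup>2 + (f2 z)\<^sup>2) has_field_derivative 2 * f z * f1 z) (at z)"
      unfolding eq0 by (auto intro!: derivative_eq_intros f)
    ultimately have "2 * f1 z * f2 z + 2 * f2 z * f3 z = 2 * f z * f1 z"
      by (rule DERIV_unique)
    then have "2 * (f2 z * (f1 z + f3 z)) = 2 * (f z * f1 z)"
      by (simp add: algebra_simps)
    then show ?thesis by simp
  qed
  have f2nz: "f2 z \<noteq> 0" for z
  proof
    assume "f2 z = 0"
    then have "f z * f1 z = 0" "(f1 z)\<^sup>2 = (f z)\<^sup>2" using eq1[of z] eq0[of z] by auto
    then show False using no_common_zero[of z] by auto
  qed
  define D where "D = (\<lambda>z. f z + f1 z)"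
  have Dnz: "D z \<noteq> 0" for z
  proof
    assume "D z = 0"
    then have "f1 z = - f z" by (simp add: D_def eq_neg_iff_add_eq_0 add.commute)
    then show False using eq0[of z] f2nz[of z] by simp
  qed
  define S where "S = (\<lambda>z. f2 z / D z)"
  have Snz: "S z \<noteq> 0" for z using f2nz Dnz by (simp add: S_def)
  have Sderiv: "(S has_field_derivative ((f1 z)\<^sup>2 - f z * f2 z) / (D z)\<^sup>2 / S z) (at z)" for z
  proof -
    have quotient: "(S has_field_derivative (f3 z * D z - f2 z * (f1 z + f2 z)) / (D z * D z)) (at z)"
      unfolding S_def
    proof (intro DERIV_divide f2 Dnz)
      show "(D has_field_derivative f1 z + f2 z) (at z)"
        unfolding D_def by (rule DERIV_add[OF f f1])
    qed
    \<comment> \<open>Multiplying by \<open>f2 z\<close> allows \<open>f3 z\<close> to be eliminated through \<open>eq1\<close>.\<close>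
    have "(f3 z * D z - f2 z * (f1 z + f2 z)) * f2 z = ((f1 z)\<^sup>2 - f z * f2 z) * D z"
      using eq0[of z] eq1[of z] unfolding D_def by algebra
    then have "(f3 z * D z - f2 z * (f1 z + f2 z)) * f2 z / (D z * D z * f2 z)
        = ((f1 z)\<^sup>2 - f z * f2 z) * D z / (D z * D z * f2 z)"
      by (rule arg_cong)
    then have "(f3 z * D z - f2 z * (f1 z + f2 z)) / (D z * D z)
        = ((f1 z)\<^sup>2 - f z * f2 z) / (D z)\<^sup>2 / S z"
      using f2nz[of z] by (simp add: S_def power2_eq_square)
    then show ?thesis using quotient by simp
  qed
  define p :: "complex poly" where "p = [:1/4, -1/2, -1/2, -1/2, 1/4:]"
  have Sp: "((f1 z)\<^sup>2 - f z * f2 z) / (D z)\<^sup>2 = poly p (S z)" for z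
  proof -
    have "(f2 z)\<^sup>2 = (f z - f1 z) * D z" using eq0[of z] unfolding D_def by algebra
    then have "(S z)\<^sup>2 = (f z - f1 z) / D z"
      using Dnz[of z] by (simp add: S_def power_divide power2_eq_square)
    moreover have "f z + f1 z \<noteq> 0" using Dnz[of z] by (simp add: D_def)
    ultimately have "1 - (S z)\<^sup>2 = 2 * f1 z / D z" "1 + (S z)\<^sup>2 = 2 * f z / D z"
      by (simp_all add: D_def add_divide_distrib diff_divide_distrib) (simp_all add: divide_simps)
    moreover have "poly p (S z) = ((1 - (S z)\<^sup>2)\<^sup>2 - 2 * S z * (1 + (S z)\<^sup>2)) / 4"
      by (simp add: p_def algebra_simps power2_eq_square add_divide_distrib diff_divide_distrib)
    ultimately have "poly p (S z) = ((2 * f1 z / D z)\<^sup>2 - 2 * S z * (2 * f z / D z)) / 4"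
      by simp
    also have "\<dots> = ((f1 z)\<^sup>2 - f z * f2 z) / (D z)\<^sup>2"
      using Dnz[of z] by (simp add: S_def field_simps power2_eq_square)
    finally show ?thesis by simp
  qed
  obtain c where c: "S = (\<lambda>_. c)"
    using zero_free_autonomous_constant[of S p] Sderiv Snz unfolding Sp by (auto simp: p_def)
  have "((f1 b)\<^sup>2 - f b * f2 b) / (D b)\<^sup>2 / S b = 0"
    using DERIV_unique[OF Sderiv[of b], of 0] by (simp add: c)
  then have "f1 b = 0" using b Dnz Snz by simp
  then show False using no_common_zero b by blast
qed

theorem theorem3p1:
  shows "\<not> (\<exists>f :: complex \<Rightarrow> complex.
           transcendental_entire f \<and>
           infinite {z. f z = 0} \<and>
           (\<forall>z. (deriv f z)\<^sup>2 + (deriv (deriv f) z)\<^sup>2 = (f z)\<^sup>2))"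
proof
  assume "\<exists>f :: complex \<Rightarrow> complex.
           transcendental_entire f \<and>
           infinite {z. f z = 0} \<and>
           (\<forall>z. (deriv f z)\<^sup>2 + (deriv (deriv f) z)\<^sup>2 = (f z)\<^sup>2)"
  then obtain f :: "complex \<Rightarrow> complex" where f: "transcendental_entire f"
    and inf: "infinite {z. f z = 0}"
    and eq: "\<And>z. (deriv f z)\<^sup>2 + (deriv (deriv f) z)\<^sup>2 = (f z)\<^sup>2"
    by blast
  obtain b where b: "f b = 0" using inf not_finite_existsD by blast
  have "f holomorphic_on UNIV" using f by (simp add: transcendental_entire_def)
  then have "f z = 0" for z using entire_solution_with_zero eq b by blast
  then have "f = poly 0" by auto
  then show False using f unfolding transcendental_entire_def by blast
qed

end
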